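(* Let $d\ge2$, $a>0$, and let $X\subset\mathbb{R}^d\setminus\{0\}$ be a finite Euclidean $a$-code, $RX=\{\|x\|:x\in X\}$. Let $g_0:\mathbb{R}_{>0}^2\to\mathbb{R}$, $g_{ij}:\mathbb{R}_{>0}\to\mathbb{R}$ ($i\ge0$, $j\ge1$), and $h(r,s,t)=g_0(r,s)+\sum_{i\ge0,\,j\ge1}g_{ij}(r)g_{ij}(s)Q_j(t)$. Assume $h(r,s,t)\le 0$ for all $r,s\in RX$ and $t\in[-1,1]$ with $r^2+s^2-2rst\ge a^2$. Then \[\sum_{x,y\in X} g_0(\|x\|,\|y\|)\le\sum_{x\in X}h(\|x\|,\|x\|,1).\]
   Context: A finite set $X\subset\mathbb{R}^d$ is a Euclidean $a$-code if $\|x-y\|\ge a$ for all distinct $x,y\in X$. $Q_j$ is the Gegenbauer polynomial of degree $j$ for $S^{d-1}$: orthogonal on $[-1,1]$ with respect to $(1-t^2)^{(d-3)/2}$, normalized by $Q_j(1)=\dim\mathrm{Harm}_j(\mathbb{R}^d)$ (the space of homogeneous harmonic polynomials of degree $j$). *)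

theory Defs
  imports
    "HOL-Analysis.Analysis"
    "HOL-Library.Function_Algebras"
    "HOL-Computational_Algebra.Polynomial"
begin

definition euclidean_code :: "real \<Rightarrow> (real ^ 'd) set \<Rightarrow> bool" where
  "euclidean_code a X \<longleftrightarrow>
     finite X \<and> (\<forall>x\<in>X. \<forall>y\<in>X. x \<noteq> y \<longrightarrow> norm (x - y) \<ge> a)"

definition laplacian :: "(real ^ 'd \<Rightarrow> real) \<Rightarrow> real ^ 'd \<Rightarrow> real" where
  "laplacian f x = (\<Sum>k\<in>UNIV. (deriv ^^ 2) (\<lambda>u. f (x + u *\<^sub>R axis k 1)) 0)"

text \<open>Polynomials are taken as polynomial functions; over the reals this loses nothing,
  and homogeneity can then be expressed by scaling (with \<open>0 ^ 0 = 1\<close>, degree 0 gives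
  exactly the constants).\<close>

definition Harm :: "nat \<Rightarrow> (real ^ 'd \<Rightarrow> real) set" where
  "Harm j = {p. real_polynomial_function p \<and>
                (\<forall>c x. p (c *\<^sub>R x) = c ^ j * p x) \<and>
                (\<forall>x. laplacian p x = 0)}"

text \<open>The type of functions is not an instance of \<^class>\<open>real_vector\<close>, so the
  dimension is that of the locale \<^locale>\<open>vector_space\<close> with pointwise scaling.\<close>

lemma vector_space_real_fun:
  "vector_space (\<lambda>(c::real) (f::'a \<Rightarrow> real) x. c * f x)"
  by unfold_locales (auto simp: fun_eq_iff algebra_simps)

definition dim_Harm :: "'d::finite itself \<Rightarrow> nat \<Rightarrow> nat" where
  "dim_Harm (_ :: 'd itself) j =
     vector_space.dim (\<lambda>c f x. c * f x) (Harm j :: (real ^ 'd \<Rightarrow> real) set)"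

text \<open>These conditions determine the sequence \<open>Q\<close> uniquely if \<open>d \<ge> 2\<close>. The value that
  \<open>powr\<close> assigns to the weight at the end points \<open>\<plusminus>1\<close> does not affect the integral.\<close>

definition gegenbauer_polys :: "'d::finite itself \<Rightarrow> (nat \<Rightarrow> real poly) \<Rightarrow> bool" where
  "gegenbauer_polys D Q \<longleftrightarrow>
     (\<forall>j. degree (Q j) = j) \<and>
     (\<forall>i j. i \<noteq> j \<longrightarrow>
        ((\<lambda>t. poly (Q i) t * poly (Q j) t * (1 - t\<^sup>2) powr ((real CARD('d) - 3) / 2))
          has_integral 0) {-1..1}) \<and>
     (\<forall>j. poly (Q j) 1 = real (dim_Harm D j))"

end

theory Submission
  imports Defs
begin

text \<open>Summing \<open>h(\<parallel>x\<parallel>, \<parallel>y\<parallel>, cos(x, y))\<close> over all pairs, the off-diagonal terms are \<open>\<le> 0\<close> by the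
  code condition, so it suffices that each \<open>Q j\<close> is positive definite on the sphere.
  To see this without integrating over the sphere, let \<open>L f = (1 - t\<^sup>2) f'' - (d - 1) t f'\<close>.
  Orthogonality makes each \<open>Q i\<close> an eigenvector of \<open>L\<close>, with distinct eigenvalues \<open>\<lambda>\<^sub>i\<close>. The kernel
  \<open>(x \<bullet> y) ^ j\<close> is a sum of products \<open>\<phi>(x) \<phi>(y)\<close> of monomials, and replacing each \<open>\<phi>\<close> by
  \<open>(\<Delta> - \<lambda>) \<phi>\<close>, with \<open>\<Delta>\<close> the spherical Laplacian, turns a kernel \<open>f(x \<bullet> y)\<close> of this form into
  \<open>((L - \<lambda>)\<^sup>2 f)(x \<bullet> y)\<close>. Doing this for \<open>\<lambda>\<^sub>0, \<dots>, \<lambda>\<^sub>j\<^sub>-\<^sub>1\<close> leaves a nonzero multiple of \<open>Q j\<close>, whose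
  sign is fixed by \<open>Q j (1) \<ge> 0\<close>; the value of \<open>dim Harm\<close> matters only to exclude \<open>Q 0 = 0\<close>.\<close>

section \<open>The Gegenbauer differential operator\<close>

text \<open>The Laplace-Beltrami operator of the unit sphere in dimension \<open>n\<close>, acting
  on zonal functions; \<open>casimir_zonal\<close> makes this precise for
  \<open>n = CARD('d)\<close>.\<close>

definition gegenbauer_op :: "real \<Rightarrow> real poly \<Rightarrow> real poly" where
  "gegenbauer_op n f = [:1, 0, -1:] * pderiv (pderiv f) - [:0, n - 1:] * pderiv f"

definition gegenbauer_eigenvalue :: "real \<Rightarrow> nat \<Rightarrow> real" where
  "gegenbauer_eigenvalue n j = - real j * (real j + n - 2)"

lemma poly_gegenbauer_op:
  "poly (gegenbauer_op n f) t =
     (1 - t\<^sup>2) * poly (pderiv (pderiv f)) t - (n - 1) * t * poly (pderiv f) t"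
  by (simp add: gegenbauer_op_def algebra_simps power2_eq_square)

lemma gegenbauer_op_add: "gegenbauer_op n (f + g) = gegenbauer_op n f + gegenbauer_op n g"
  by (simp add: gegenbauer_op_def pderiv_add algebra_simps smult_add_right)

lemma gegenbauer_op_smult: "gegenbauer_op n (smult c f) = smult c (gegenbauer_op n f)"
  by (simp add: gegenbauer_op_def pderiv_smult algebra_simps smult_diff_right smult_add_right)

lemma gegenbauer_op_0: "gegenbauer_op n 0 = 0"
  by (simp add: gegenbauer_op_def)

lemma gegenbauer_op_sum: "gegenbauer_op n (\<Sum>i\<in>I. f i) = (\<Sum>i\<in>I. gegenbauer_op n (f i))"
  by (induction I rule: infinite_finite_induct) (simp_all add: gegenbauer_op_0 gegenbauer_op_add)

text \<open>The point is the shape: triangular in the monomial basis with the eigenvalues on the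
  diagonal. Subtracting \<open>gegenbauer_eigenvalue n j\<close> times a polynomial of degree
  \<open>j\<close> therefore cancels its leading term.\<close>

lemma coeff_gegenbauer_op:
  "coeff (gegenbauer_op n f) k =
     real ((k + 2) * (k + 1)) * coeff f (k + 2) + gegenbauer_eigenvalue n k * coeff f k"
proof -
  consider "k = 0" | "k = 1" | m where "k = Suc (Suc m)"
    by (metis One_nat_def not0_implies_Suc)
  then show ?thesis
    by cases (auto simp: gegenbauer_op_def coeff_pderiv gegenbauer_eigenvalue_def algebra_simps
        numeral_eq_Suc)
qed

lemma gegenbauer_eigenvalue_strict_antimono:
  assumes "n \<ge> 2" "i < j"
  shows "gegenbauer_eigenvalue n j < gegenbauer_eigenvalue n i"
proof -
  have "real i * (real i + n - 2) \<le> real i * (real j + n - 2)"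
    using assms by (intro mult_left_mono) auto
  also have "\<dots> < real j * (real j + n - 2)"
    using assms by (intro mult_strict_right_mono) auto
  finally show ?thesis
    by (simp add: gegenbauer_eigenvalue_def)
qed

section \<open>Orthogonality and the eigenvalue equation\<close>

definition gegenbauer_weight :: "real \<Rightarrow> real \<Rightarrow> real" where
  "gegenbauer_weight n t = (1 - t\<^sup>2) powr ((n - 3) / 2)"

text \<open>The integrand is the derivative of \<open>F\<close>, the Wronskian-like \<open>W\<close>
  times \<open>(1 - t\<^sup>2) powr ((n - 1) / 2)\<close>, and \<open>F\<close> vanishes at both end
  points. For \<open>n = 2\<close> the weight blows up there, so \<open>F\<close> is differentiated
  only in the open interval; its continuity up to the end points comes from the positive
  exponent.\<close>

lemma gegenbauer_op_self_adjoint: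
  assumes "n \<ge> 2"
  shows "((\<lambda>t. (poly (gegenbauer_op n f) t * poly g t - poly f t * poly (gegenbauer_op n g) t)
            * gegenbauer_weight n t) has_integral 0) {-1..1}"
proof -
  define W where "W = (\<lambda>t. poly (pderiv f) t * poly g t - poly f t * poly (pderiv g) t)"
  define F where "F = (\<lambda>t. (1 - t\<^sup>2) powr ((n - 1) / 2) * W t)"
  have cont: "continuous_on {-1..1} F"
    unfolding F_def W_def
    using assms
    by (intro continuous_intros continuous_on_powr') (auto simp: abs_square_le_1 abs_le_iff)
  have deriv: "(F has_vector_derivative
      (poly (gegenbauer_op n f) t * poly g t - poly f t * poly (gegenbauer_op n g) t)
        * gegenbauer_weight n t) (at t)" if "t \<in> {-1<..<1}" for t
  proof -
    have pos: "1 - t\<^sup>2 > 0"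
      using that by (auto simp: abs_square_less_1 abs_less_iff)
    have W': "(W has_real_derivative
        poly (pderiv (pderiv f)) t * poly g t - poly f t * poly (pderiv (pderiv g)) t) (at t)"
      unfolding W_def by (auto intro!: derivative_eq_intros poly_DERIV)
    have P': "((\<lambda>t. (1 - t\<^sup>2) powr ((n - 1) / 2)) has_real_derivative
        (n - 1) / 2 * (1 - t\<^sup>2) powr ((n - 1) / 2 - 1) * (- 2 * t)) (at t)"
      using pos by (auto intro!: derivative_eq_intros)
    have w: "(1 - t\<^sup>2) powr ((n - 1) / 2) = (1 - t\<^sup>2) * gegenbauer_weight n t"
      using pos powr_add[of "1 - t\<^sup>2" 1 "(n - 3) / 2"]
      by (simp add: gegenbauer_weight_def field_simps)
    have w': "(1 - t\<^sup>2) powr ((n - 1) / 2 - 1) = gegenbauer_weight n t"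
      by (simp add: gegenbauer_weight_def field_simps)
    show ?thesis
      unfolding has_real_derivative_iff_has_vector_derivative[symmetric] F_def
      by (rule DERIV_cong[OF DERIV_mult[OF P' W']])
        (simp only: w w' poly_gegenbauer_op, simp add: W_def field_simps)
  qed
  have "F 1 - F (-1) = 0"
    by (simp add: F_def)
  then show ?thesis
    using fundamental_theorem_of_calculus_interior[OF _ cont deriv] by simp
qed

lemma poly_eq_0_if_weighted_square_integral_0:
  assumes "((\<lambda>t. (poly r t)\<^sup>2 * gegenbauer_weight n t) has_integral 0) {-1..1}"
  shows "r = 0"
proof -
  let ?f = "\<lambda>t. (poly r t)\<^sup>2 * gegenbauer_weight n t"
  have nonneg: "?f t \<ge> 0" for t
    by (simp add: gegenbauer_weight_def)
  \<comment> \<open>On this smaller interval the weight is continuous and positive, whatever its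
    exponent, and infinitely many roots are still available.\<close>
  have int: "?f integrable_on {-1/2..1/2}"
    by (rule integrable_on_subinterval[OF has_integral_integrable[OF assms]]) simp
  have "integral {-1/2..1/2} ?f \<le> 0"
    by (rule has_integral_subset_le[OF _ integrable_integral[OF int] assms]) (auto simp: nonneg)
  moreover have "integral {-1/2..1/2} ?f \<ge> 0"
    by (rule integral_nonneg[OF int nonneg])
  ultimately have int0: "(?f has_integral 0) (cbox (-1/2) (1/2))"
    using integrable_integral[OF int] by (simp add: cbox_interval)
  have pos: "1 - t\<^sup>2 > 0" if "t \<in> cbox (-1/2) (1/2)" for t :: real
    using that abs_square_less_1[of t] by auto
  have "continuous_on (cbox (-1/2) (1/2)) ?f"
    unfolding gegenbauer_weight_def using pos
    by (intro continuous_intros ballI) fastforce+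
  then have *: "?f t = 0" if "t \<in> cbox (-1/2) (1/2)" for t
    by (rule has_integral_0_cbox_imp_0[OF _ nonneg int0]) (use that in auto)
  have "poly r t = 0" if "t \<in> {-1/2..1/2}" for t
    using *[of t] pos[of t] that by (auto simp: gegenbauer_weight_def)
  then have "{-1/2..1/2} \<subseteq> {t. poly r t = 0}"
    by blast
  moreover have "infinite {-1/2..1/2::real}"
    by (simp add: infinite_Icc)
  ultimately show "r = 0"
    using poly_roots_finite[of r] finite_subset by blast
qed

lemma smult_sum_right: "smult a (\<Sum>i\<in>I. f i) = (\<Sum>i\<in>I. smult a (f i))"
  by (induction I rule: infinite_finite_induct) (simp_all add: smult_add_right)

text \<open>Triangular elimination: a multiple of \<open>Q m\<close> removes the coefficient at
  \<open>m\<close>. Bounding \<open>r\<close> by its coefficients instead of its degree lets the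
  induction start at \<open>r = 0\<close>.\<close>

lemma poly_in_span_of_degrees:
  fixes Q :: "nat \<Rightarrow> 'a::field poly"
  assumes deg: "\<And>i. degree (Q i) = i" and nz: "\<And>i. Q i \<noteq> 0"
    and "\<And>k. k \<ge> m \<Longrightarrow> coeff r k = 0"
  shows "\<exists>c. r = (\<Sum>i<m. smult (c i) (Q i))"
  using assms(3)
proof (induction m arbitrary: r)
  case 0
  then show ?case
    by (auto simp: poly_eq_iff)
next
  case (Suc m)
  define b where "b = coeff r m / coeff (Q m) m"
  have lc: "coeff (Q m) m \<noteq> 0"
    using deg[of m] nz[of m] leading_coeff_0_iff by metis
  have "coeff (r - smult b (Q m)) k = 0" if "k \<ge> m" for k
  proof (cases "k = m")
    case False
    with that have "coeff (Q m) k = 0"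
      by (intro coeff_eq_0) (simp add: deg)
    with False that Suc.prems[of k] show ?thesis
      by simp
  qed (use lc in \<open>simp add: b_def\<close>)
  from Suc.IH[OF this] obtain c where c: "r - smult b (Q m) = (\<Sum>i<m. smult (c i) (Q i))"
    by blast
  have "r = (\<Sum>i<Suc m. smult ((c(m := b)) i) (Q i))"
    using c by (simp add: algebra_simps)
  then show ?case
    by blast
qed

text \<open>The defect \<open>r\<close> has degree below \<open>j\<close>, hence lies in the span of
  the earlier \<open>Q i\<close>. It is orthogonal to each of them by self-adjointness and the
  induction hypothesis, so it is orthogonal to itself.\<close>

lemma gegenbauer_op_eigenpoly:
  fixes Q :: "nat \<Rightarrow> real poly"
  assumes n: "n \<ge> 2" and deg: "\<And>i. degree (Q i) = i" and nz: "\<And>i. Q i \<noteq> 0"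
    and orth: "\<And>i j. i \<noteq> j \<Longrightarrow>
      ((\<lambda>t. poly (Q i) t * poly (Q j) t * gegenbauer_weight n t) has_integral 0) {-1..1}"
  shows "gegenbauer_op n (Q j) = smult (gegenbauer_eigenvalue n j) (Q j)"
proof (induction j rule: less_induct)
  case (less j)
  define r where "r = gegenbauer_op n (Q j) - smult (gegenbauer_eigenvalue n j) (Q j)"
  have "coeff r k = 0" if "k \<ge> j" for k
    using that deg[of j]
    by (cases "k = j") (auto simp: r_def coeff_gegenbauer_op coeff_eq_0)
  from poly_in_span_of_degrees[OF deg nz this]
  obtain c where c: "r = (\<Sum>i<j. smult (c i) (Q i))"
    by blast
  have r_orth: "((\<lambda>t. poly r t * poly (Q i) t * gegenbauer_weight n t) has_integral 0) {-1..1}"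
    if "i < j" for i
  proof -
    \<comment> \<open>Since \<open>Q i\<close> is already an eigenvector, adding this multiple of
      the orthogonality relation turns the self-adjointness integrand into \<open>r\<close> times
      \<open>Q i\<close>.\<close>
    have "((\<lambda>t. (poly (gegenbauer_op n (Q j)) t * poly (Q i) t
                 - poly (Q j) t * poly (gegenbauer_op n (Q i)) t) * gegenbauer_weight n t
              + (gegenbauer_eigenvalue n i - gegenbauer_eigenvalue n j)
                  * (poly (Q j) t * poly (Q i) t * gegenbauer_weight n t))
            has_integral 0 + (gegenbauer_eigenvalue n i - gegenbauer_eigenvalue n j) * 0) {-1..1}"
      by (rule has_integral_add[OF gegenbauer_op_self_adjoint[OF n]
            has_integral_mult_right[OF orth]]) (use that in simp)
    moreover have "(poly (gegenbauer_op n (Q j)) t * poly (Q i) t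
                 - poly (Q j) t * poly (gegenbauer_op n (Q i)) t) * gegenbauer_weight n t
              + (gegenbauer_eigenvalue n i - gegenbauer_eigenvalue n j)
                  * (poly (Q j) t * poly (Q i) t * gegenbauer_weight n t)
        = poly r t * poly (Q i) t * gegenbauer_weight n t" for t
      unfolding r_def less.IH[OF that] poly_diff poly_smult by algebra
    ultimately show ?thesis
      by simp
  qed
  have "((\<lambda>t. \<Sum>i<j. c i * (poly r t * poly (Q i) t * gegenbauer_weight n t))
          has_integral (\<Sum>i<j. c i * 0)) {-1..1}"
    by (intro has_integral_sum has_integral_mult_right r_orth) auto
  moreover have "(\<Sum>i<j. c i * (poly r t * poly (Q i) t * gegenbauer_weight n t))
      = (poly r t)\<^sup>2 * gegenbauer_weight n t" for t
  proof -
    have "poly r t = (\<Sum>i<j. c i * poly (Q i) t)"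
      by (simp add: c poly_sum)
    then have "(poly r t)\<^sup>2 * gegenbauer_weight n t
        = poly r t * (\<Sum>i<j. c i * poly (Q i) t) * gegenbauer_weight n t"
      by (simp add: power2_eq_square)
    then show ?thesis
      by (simp add: sum_distrib_left sum_distrib_right ac_simps)
  qed
  ultimately have "r = 0"
    by (intro poly_eq_0_if_weighted_square_integral_0) simp
  then show ?case
    by (simp add: r_def)
qed

section \<open>Rotations and the Casimir operator\<close>

definition rot_gen :: "'d \<Rightarrow> 'd \<Rightarrow> real ^ 'd \<Rightarrow> real ^ 'd::finite" where
  "rot_gen a b x = x $ a *\<^sub>R axis b 1 - x $ b *\<^sub>R axis a 1"

text \<open>Rodrigues' formula for \<open>exp (\<theta> * rot_gen a b)\<close>; it is the identity if \<open>a = b\<close>.\<close>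

definition rot :: "'d \<Rightarrow> 'd \<Rightarrow> real \<Rightarrow> real ^ 'd \<Rightarrow> real ^ 'd::finite" where
  "rot a b \<theta> x = x + sin \<theta> *\<^sub>R rot_gen a b x + (1 - cos \<theta>) *\<^sub>R rot_gen a b (rot_gen a b x)"

lemma bounded_linear_rot_gen: "bounded_linear (rot_gen a b)"
  unfolding rot_gen_def
  by (intro bounded_linear_sub bounded_linear_compose[OF bounded_linear_scaleR_left]
      bounded_linear_vec_nth)

lemmas rot_gen_add = bounded_linear.linear[OF bounded_linear_rot_gen, THEN linear_add]
lemmas rot_gen_scaleR = bounded_linear.linear[OF bounded_linear_rot_gen, THEN linear_scale]

lemma rot_0 [simp]: "rot a b 0 x = x"
  by (simp add: rot_def)

lemma inner_rot_gen_right: "x \<bullet> rot_gen a b y = x $ b * y $ a - x $ a * y $ b"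
  by (simp add: rot_gen_def inner_diff_right inner_axis)

lemma rot_gen_antisym: "rot_gen a b x \<bullet> y = - (x \<bullet> rot_gen a b y)"
  by (subst inner_commute) (simp add: inner_rot_gen_right)

text \<open>For distinct \<open>a\<close>, \<open>b\<close> the generator is a quarter turn on their
  coordinate plane and zero on its complement; otherwise it is zero.\<close>

lemma rot_gen_cube: "rot_gen a b (rot_gen a b (rot_gen a b x)) = - rot_gen a b x"
  by (cases "a = b") (auto simp: rot_gen_def vec_eq_iff axis_def)

text \<open>The right-hand side is the derivative of \<open>rot a b \<theta> x\<close> in
  \<open>\<theta>\<close>, so \<open>rot\<close> is the flow of \<open>rot_gen\<close>.\<close>

lemma rot_gen_rot:
  "rot_gen a b (rot a b \<theta> x) =
     cos \<theta> *\<^sub>R rot_gen a b x + sin \<theta> *\<^sub>R rot_gen a b (rot_gen a b x)"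
  unfolding rot_def rot_gen_add rot_gen_scaleR rot_gen_cube by (simp add: algebra_simps)

text \<open>Antisymmetry of the generator reduces all cross terms to multiples of one square norm,
  with total factor \<open>s\<^sup>2 + c\<^sup>2 - 1\<close>. Identities known only on the unit
  sphere can thus be differentiated along \<open>rot\<close>.\<close>

lemma norm_rot [simp]: "norm (rot a b \<theta> x) = norm x"
proof -
  let ?J = "rot_gen a b"
  have zero: "z \<bullet> ?J z = 0" for z
    by (simp add: inner_rot_gen_right)
  have J: "x \<bullet> ?J x = 0" "?J x \<bullet> x = 0"
    using zero[of x] inner_commute[of x "?J x"] by linarith+
  have J2: "x \<bullet> ?J (?J x) = - (?J x \<bullet> ?J x)" "?J (?J x) \<bullet> x = - (?J x \<bullet> ?J x)"
    using rot_gen_antisym[of a b x "?J x"] inner_commute[of x "?J (?J x)"] by linarith+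
  have J3: "?J x \<bullet> ?J (?J x) = 0" "?J (?J x) \<bullet> ?J x = 0"
    using zero[of "?J x"] inner_commute[of "?J x" "?J (?J x)"] by linarith+
  have J4: "?J (?J x) \<bullet> ?J (?J x) = ?J x \<bullet> ?J x"
    unfolding rot_gen_antisym[of a b "?J x"] rot_gen_cube inner_minus_right by simp
  define s c where "s = sin \<theta>" and "c = cos \<theta>"
  have sc: "s\<^sup>2 + c\<^sup>2 = 1"
    by (simp add: s_def c_def)
  have "rot a b \<theta> x \<bullet> rot a b \<theta> x = x \<bullet> x + (s\<^sup>2 + c\<^sup>2 - 1) * (?J x \<bullet> ?J x)"
    unfolding rot_def s_def[symmetric] c_def[symmetric] inner_add_left inner_add_right
      inner_scaleR_left inner_scaleR_right J J2 J3 J4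
    by algebra
  then have "rot a b \<theta> x \<bullet> rot a b \<theta> x = x \<bullet> x"
    by (simp add: sc)
  then show ?thesis
    by (simp add: norm_eq_sqrt_inner)
qed

lemma has_real_derivative_linear_rot:
  assumes "bounded_linear f"
  shows "((\<lambda>\<theta>. f (rot a b \<theta> x)) has_real_derivative f (rot_gen a b (rot a b \<theta> x))) (at \<theta>)"
proof -
  have lin: "linear f"
    using assms by (rule bounded_linear.linear)
  show ?thesis
    unfolding rot_gen_rot unfolding rot_def
    by (simp add: linear_add[OF lin] linear_scale[OF lin])
      (auto intro!: derivative_eq_intros)
qed

text \<open>For linear \<open>f\<close> the derivative is \<open>f\<close> composed with the
  generator; sum and product rules do the rest. That \<open>\<psi>\<close> is again polynomial
  allows differentiating twice.\<close>

lemma ex_rot_deriv: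
  fixes \<phi> :: "real ^ 'd::finite \<Rightarrow> real"
  assumes "real_polynomial_function \<phi>"
  shows "\<exists>\<psi>. real_polynomial_function \<psi> \<and>
    (\<forall>x \<theta>. ((\<lambda>\<theta>. \<phi> (rot a b \<theta> x)) has_real_derivative \<psi> (rot a b \<theta> x)) (at \<theta>))"
  using assms
proof induction
  case (linear f)
  then have "real_polynomial_function (\<lambda>x. f (rot_gen a b x))"
    by (intro real_polynomial_function.intros(1) bounded_linear_compose[OF _ bounded_linear_rot_gen])
  with has_real_derivative_linear_rot[OF linear] show ?case
    by blast
next
  case (const c)
  have "real_polynomial_function (\<lambda>x::real ^ 'd. 0)"
    by blast
  then show ?case
    by (intro exI[of _ "\<lambda>_. 0"]) auto
next
  case (add f g)
  then obtain f' g' where "real_polynomial_function f'" "real_polynomial_function g'"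
    "\<And>x \<theta>. ((\<lambda>\<theta>. f (rot a b \<theta> x)) has_real_derivative f' (rot a b \<theta> x)) (at \<theta>)"
    "\<And>x \<theta>. ((\<lambda>\<theta>. g (rot a b \<theta> x)) has_real_derivative g' (rot a b \<theta> x)) (at \<theta>)"
    by blast
  then show ?case
    by (intro exI[of _ "\<lambda>x. f' x + g' x"]) (auto intro: DERIV_add)
next
  case (mult f g)
  then obtain f' g' where "real_polynomial_function f'" "real_polynomial_function g'"
    "\<And>x \<theta>. ((\<lambda>\<theta>. f (rot a b \<theta> x)) has_real_derivative f' (rot a b \<theta> x)) (at \<theta>)"
    "\<And>x \<theta>. ((\<lambda>\<theta>. g (rot a b \<theta> x)) has_real_derivative g' (rot a b \<theta> x)) (at \<theta>)"
    by blast
  with mult.hyps show ?case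
    by (intro exI[of _ "\<lambda>x. f' x * g x + g' x * f x"]) (auto intro: DERIV_mult)
qed

definition rot_deriv :: "'d \<Rightarrow> 'd \<Rightarrow> (real ^ 'd::finite \<Rightarrow> real) \<Rightarrow> real ^ 'd \<Rightarrow> real" where
  "rot_deriv a b \<phi> x = deriv (\<lambda>\<theta>. \<phi> (rot a b \<theta> x)) 0"

lemma
  assumes "real_polynomial_function \<phi>"
  shows real_polynomial_function_rot_deriv: "real_polynomial_function (rot_deriv a b \<phi>)"
    and has_real_derivative_rot_deriv:
      "((\<lambda>\<theta>. \<phi> (rot a b \<theta> x)) has_real_derivative rot_deriv a b \<phi> x) (at 0)"
proof -
  obtain \<psi> where \<psi>: "real_polynomial_function \<psi>"
    "\<And>x \<theta>. ((\<lambda>\<theta>. \<phi> (rot a b \<theta> x)) has_real_derivative \<psi> (rot a b \<theta> x)) (at \<theta>)"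
    using ex_rot_deriv[OF assms] by metis
  have eq: "rot_deriv a b \<phi> = \<psi>"
    using \<psi>(2)[of _ 0] by (auto simp: rot_deriv_def fun_eq_iff intro: DERIV_imp_deriv)
  show "real_polynomial_function (rot_deriv a b \<phi>)"
    "((\<lambda>\<theta>. \<phi> (rot a b \<theta> x)) has_real_derivative rot_deriv a b \<phi> x) (at 0)"
    using \<psi>(1) \<psi>(2)[of x 0] by (simp_all add: eq)
qed

text \<open>The factor 1/2 compensates for summing over ordered pairs: restricted to the sphere,
  this is the Laplace-Beltrami operator.\<close>

definition casimir :: "(real ^ 'd::finite \<Rightarrow> real) \<Rightarrow> real ^ 'd \<Rightarrow> real" where
  "casimir \<phi> x = (\<Sum>a\<in>UNIV. \<Sum>b\<in>UNIV. rot_deriv a b (rot_deriv a b \<phi>) x) / 2"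

lemma real_polynomial_function_casimir:
  "real_polynomial_function \<phi> \<Longrightarrow> real_polynomial_function (casimir \<phi>)"
  unfolding casimir_def
  by (intro real_polynomial_function_divide real_polynomial_function_sum
      real_polynomial_function_rot_deriv) auto

text \<open>Lagrange's identity over ordered pairs. On unit vectors, half of it is the coefficient
  \<open>1 - t\<^sup>2\<close> of the second derivative.\<close>

lemma sum_inner_rot_gen_squared:
  fixes x y :: "real ^ 'd::finite"
  shows "(\<Sum>a\<in>UNIV. \<Sum>b\<in>UNIV. (x \<bullet> rot_gen a b y)\<^sup>2) = 2 * ((x \<bullet> x) * (y \<bullet> y) - (x \<bullet> y)\<^sup>2)"
proof -
  have "(x \<bullet> rot_gen a b y)\<^sup>2 = (x $ b * x $ b) * (y $ a * y $ a) + (x $ a * x $ a) * (y $ b * y $ b)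
      - 2 * ((x $ a * y $ a) * (x $ b * y $ b))" for a b
    by (simp add: inner_rot_gen_right power2_eq_square algebra_simps)
  moreover have "(\<Sum>a\<in>UNIV. \<Sum>b\<in>UNIV. (x $ b * x $ b) * (y $ a * y $ a)) = (x \<bullet> x) * (y \<bullet> y)"
    by (simp add: inner_vec_def sum_product) (rule sum.swap)
  moreover have "(\<Sum>a\<in>UNIV. \<Sum>b\<in>UNIV. (x $ a * x $ a) * (y $ b * y $ b)) = (x \<bullet> x) * (y \<bullet> y)"
    by (simp add: inner_vec_def sum_product)
  moreover have "(\<Sum>a\<in>UNIV. \<Sum>b\<in>UNIV. 2 * ((x $ a * y $ a) * (x $ b * y $ b))) = 2 * (x \<bullet> y)\<^sup>2"
    by (simp add: inner_vec_def sum_product power2_eq_square flip: sum_distrib_left)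
  ultimately show ?thesis
    by (simp add: sum.distrib sum_subtractf)
qed

text \<open>Each squared generator with distinct indices is minus the projection onto its plane, and
  each coordinate lies in \<open>CARD('d) - 1\<close> planes, counted twice. Half of it gives the
  first-order coefficient.\<close>

lemma sum_inner_rot_gen_rot_gen:
  fixes x y :: "real ^ 'd::finite"
  shows "(\<Sum>a\<in>UNIV. \<Sum>b\<in>UNIV. x \<bullet> rot_gen a b (rot_gen a b y))
      = - 2 * (real CARD('d) - 1) * (x \<bullet> y)"
proof -
  \<comment> \<open>The conditional term cancels the other two when \<open>a = b\<close>, where the
    generator vanishes.\<close>
  have "x \<bullet> rot_gen a b (rot_gen a b y) =
      (if b = a then 2 * (x $ a * y $ a) else 0) - x $ a * y $ a - x $ b * y $ b" for a b
    by (simp add: inner_rot_gen_right) (simp add: rot_gen_def axis_def)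
  then have "(\<Sum>a\<in>UNIV. \<Sum>b\<in>UNIV. x \<bullet> rot_gen a b (rot_gen a b y)) =
      (\<Sum>a\<in>UNIV. 2 * (x $ a * y $ a) - real CARD('d) * (x $ a * y $ a) - x \<bullet> y)"
    by (simp add: sum_subtractf inner_vec_def)
  also have "\<dots> = - 2 * (real CARD('d) - 1) * (x \<bullet> y)"
    by (simp add: sum_subtractf sum.distrib inner_vec_def algebra_simps sum_distrib_left)
  finally show ?thesis .
qed

lemma DERIV_poly_inner_rot:
  "((\<lambda>\<theta>. poly p (x \<bullet> rot a b \<theta> y)) has_real_derivative
     poly (pderiv p) (x \<bullet> y) * (x \<bullet> rot_gen a b y)) (at 0)"
proof -
  have "((\<lambda>\<theta>. x \<bullet> rot a b \<theta> y) has_real_derivative x \<bullet> rot_gen a b y) (at 0)"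
    using has_real_derivative_linear_rot[OF bounded_linear_inner_right, of x a b y 0] by simp
  from DERIV_chain2[OF poly_DERIV this] show ?thesis
    by simp
qed

text \<open>Only the combination of the \<open>\<phi> i\<close> need be zonal. Rotations preserve
  the sphere, so \<open>eq\<close> holds along the curves and both sides have equal derivatives,
  twice over.\<close>

lemma casimir_zonal:
  fixes \<phi> :: "'i \<Rightarrow> real ^ 'd::finite \<Rightarrow> real"
  assumes poly: "\<And>i. i \<in> I \<Longrightarrow> real_polynomial_function (\<phi> i)"
    and x: "norm x = 1"
    and eq: "\<And>y. norm y = 1 \<Longrightarrow> (\<Sum>i\<in>I. c i * \<phi> i y) = poly p (x \<bullet> y)"
    and y: "norm y = 1"
  shows "(\<Sum>i\<in>I. c i * casimir (\<phi> i) y) = poly (gegenbauer_op (real CARD('d)) p) (x \<bullet> y)"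
proof -
  \<comment> \<open>Proved for all unit vectors, because \<open>second\<close> differentiates this
    identity along a curve.\<close>
  have first: "(\<Sum>i\<in>I. c i * rot_deriv a b (\<phi> i) y)
      = poly (pderiv p) (x \<bullet> y) * (x \<bullet> rot_gen a b y)" if y: "norm y = 1" for a b y
  proof (rule DERIV_unique)
    show "((\<lambda>\<theta>. \<Sum>i\<in>I. c i * \<phi> i (rot a b \<theta> y)) has_real_derivative
        (\<Sum>i\<in>I. c i * rot_deriv a b (\<phi> i) y)) (at 0)"
      by (intro DERIV_sum DERIV_cmult has_real_derivative_rot_deriv poly)
    show "((\<lambda>\<theta>. \<Sum>i\<in>I. c i * \<phi> i (rot a b \<theta> y)) has_real_derivative
        poly (pderiv p) (x \<bullet> y) * (x \<bullet> rot_gen a b y)) (at 0)"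
      using DERIV_poly_inner_rot[of p x a b y] y by (simp add: eq)
  qed
  have second: "(\<Sum>i\<in>I. c i * rot_deriv a b (rot_deriv a b (\<phi> i)) y)
      = poly (pderiv (pderiv p)) (x \<bullet> y) * (x \<bullet> rot_gen a b y)\<^sup>2
        + poly (pderiv p) (x \<bullet> y) * (x \<bullet> rot_gen a b (rot_gen a b y))" for a b
  proof (rule DERIV_unique)
    show "((\<lambda>\<theta>. \<Sum>i\<in>I. c i * rot_deriv a b (\<phi> i) (rot a b \<theta> y)) has_real_derivative
        (\<Sum>i\<in>I. c i * rot_deriv a b (rot_deriv a b (\<phi> i)) y)) (at 0)"
      by (intro DERIV_sum DERIV_cmult has_real_derivative_rot_deriv
          real_polynomial_function_rot_deriv poly)
    have J: "((\<lambda>\<theta>. x \<bullet> rot_gen a b (rot a b \<theta> y)) has_real_derivative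
        x \<bullet> rot_gen a b (rot_gen a b y)) (at 0)"
      using has_real_derivative_linear_rot[OF bounded_linear_compose[OF bounded_linear_inner_right
            bounded_linear_rot_gen], of x a b a b y 0]
      by simp
    show "((\<lambda>\<theta>. \<Sum>i\<in>I. c i * rot_deriv a b (\<phi> i) (rot a b \<theta> y)) has_real_derivative
        poly (pderiv (pderiv p)) (x \<bullet> y) * (x \<bullet> rot_gen a b y)\<^sup>2
        + poly (pderiv p) (x \<bullet> y) * (x \<bullet> rot_gen a b (rot_gen a b y))) (at 0)"
      using DERIV_mult[OF DERIV_poly_inner_rot[of "pderiv p" x a b y] J] y
      by (simp add: first power2_eq_square algebra_simps)
  qed
  have "(\<Sum>i\<in>I. c i * casimir (\<phi> i) y)
      = (\<Sum>a\<in>UNIV. \<Sum>b\<in>UNIV. \<Sum>i\<in>I. c i * rot_deriv a b (rot_deriv a b (\<phi> i)) y) / 2"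
  proof -
    have "(\<Sum>i\<in>I. c i * casimir (\<phi> i) y)
      = (\<Sum>i\<in>I. \<Sum>a\<in>UNIV. \<Sum>b\<in>UNIV. c i * rot_deriv a b (rot_deriv a b (\<phi> i)) y) / 2"
      by (simp add: casimir_def sum_distrib_left sum_divide_distrib)
    also have "(\<Sum>i\<in>I. \<Sum>a\<in>UNIV. \<Sum>b\<in>UNIV. c i * rot_deriv a b (rot_deriv a b (\<phi> i)) y)
      = (\<Sum>a\<in>UNIV. \<Sum>b\<in>UNIV. \<Sum>i\<in>I. c i * rot_deriv a b (rot_deriv a b (\<phi> i)) y)"
      by (subst sum.swap, rule sum.cong[OF refl], rule sum.swap)
    finally show ?thesis .
  qed
  also have "\<dots> = (poly (pderiv (pderiv p)) (x \<bullet> y)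
          * (\<Sum>a\<in>UNIV. \<Sum>b\<in>UNIV. (x \<bullet> rot_gen a b y)\<^sup>2)
        + poly (pderiv p) (x \<bullet> y)
          * (\<Sum>a\<in>UNIV. \<Sum>b\<in>UNIV. x \<bullet> rot_gen a b (rot_gen a b y))) / 2"
    by (simp add: second sum.distrib sum_distrib_left)
  also have "\<dots> = poly (gegenbauer_op (real CARD('d)) p) (x \<bullet> y)"
    using x y
    by (simp add: sum_inner_rot_gen_squared sum_inner_rot_gen_rot_gen poly_gegenbauer_op
        flip: power2_norm_eq_inner) (simp add: field_simps)
  finally show ?thesis .
qed

section \<open>Kernels given by polynomial features\<close>

text \<open>The index type of the features is fixed to words over the coordinates, which is what the
  expansion of \<open>(x \<bullet> y) ^ j\<close> needs.\<close>

definition feature_poly :: "'d::finite itself \<Rightarrow> real poly \<Rightarrow> bool" where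
  "feature_poly D p \<longleftrightarrow> (\<exists>(I :: 'd list set) \<phi>. finite I \<and>
     (\<forall>i\<in>I. real_polynomial_function (\<phi> i :: real ^ 'd \<Rightarrow> real)) \<and>
     (\<forall>x y. norm x = 1 \<longrightarrow> norm y = 1 \<longrightarrow> poly p (x \<bullet> y) = (\<Sum>i\<in>I. \<phi> i x * \<phi> i y)))"

text \<open>Expand the power of the coordinate sum without collecting terms: one product per word of
  length \<open>j\<close>.\<close>

lemma feature_poly_monom: "feature_poly TYPE('d::finite) (monom 1 j)"
proof -
  define \<phi> :: "'d list \<Rightarrow> real ^ 'd \<Rightarrow> real" where "\<phi> w x = prod_list (map (($) x) w)" for w x
  have \<phi>: "real_polynomial_function (\<phi> w)" for w
  proof (induction w)
    case (Cons k w)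
    have "real_polynomial_function (\<lambda>x::real ^ 'd. x $ k)"
      by (intro real_polynomial_function.intros(1) bounded_linear_vec_nth)
    with Cons have "real_polynomial_function (\<lambda>x. x $ k * \<phi> w x)"
      by (intro real_polynomial_function.intros(4))
    then show ?case
      by (simp add: \<phi>_def[abs_def])
  qed (auto simp: \<phi>_def[abs_def])
  have "finite {w :: 'd list. length w = j} \<and>
    (\<forall>x y. (x \<bullet> y) ^ j = (\<Sum>w | length w = j. \<phi> w x * \<phi> w y))"
  proof (induction j)
    case 0
    then show ?case
      by (simp add: \<phi>_def)
  next
    case (Suc j)
    have words: "{w :: 'd list. length w = Suc j} = (\<lambda>(k, w). k # w) ` (UNIV \<times> {w. length w = j})"
      by (auto simp: length_Suc_conv)
    have inj: "inj_on (\<lambda>(k, w). k # w) (UNIV \<times> {w :: 'd list. length w = j})"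
      by (auto simp: inj_on_def)
    have "(x \<bullet> y) ^ Suc j = (\<Sum>w | length w = Suc j. \<phi> w x * \<phi> w y)" for x y
    proof -
      have "(\<Sum>w | length w = Suc j. \<phi> w x * \<phi> w y)
          = (\<Sum>k\<in>UNIV. \<Sum>w | length w = j. (x $ k * y $ k) * (\<phi> w x * \<phi> w y))"
        unfolding words sum.reindex[OF inj] sum.cartesian_product
        by (intro sum.cong) (auto simp: \<phi>_def)
      also have "\<dots> = (x \<bullet> y) * (\<Sum>w | length w = j. \<phi> w x * \<phi> w y)"
        by (simp add: inner_vec_def sum_product)
      finally show ?thesis
        using Suc.IH by simp
    qed
    with Suc.IH show ?case
      by (simp add: words)
  qed
  then show ?thesis
    unfolding feature_poly_def using \<phi>
    by (intro exI[of _ "{w. length w = j}"] exI[of _ \<phi>]) (simp add: poly_monom)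
qed

text \<open>\<open>T\<close> acts once in each variable, so the same new features
  \<open>\<psi>\<close> appear on both sides of the kernel.\<close>

lemma feature_poly_gegenbauer_op:
  fixes p :: "real poly" and c :: real
  defines "T \<equiv> \<lambda>f. gegenbauer_op (real CARD('d)) f - smult c f"
  assumes "feature_poly TYPE('d::finite) p"
  shows "feature_poly TYPE('d) (T (T p))"
proof -
  obtain I :: "'d list set" and \<phi> :: "'d list \<Rightarrow> real ^ 'd \<Rightarrow> real" where "finite I"
    and \<phi>: "\<And>i. i \<in> I \<Longrightarrow> real_polynomial_function (\<phi> i)"
    and eq: "\<And>x y. norm x = 1 \<Longrightarrow> norm y = 1 \<Longrightarrow> poly p (x \<bullet> y) = (\<Sum>i\<in>I. \<phi> i x * \<phi> i y)"
    using assms(2) unfolding feature_poly_def by blast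
  define \<psi> where "\<psi> i x = casimir (\<phi> i) x - c * \<phi> i x" for i x
  have \<psi>: "real_polynomial_function (\<psi> i)" if "i \<in> I" for i
    unfolding \<psi>_def using \<phi>[OF that]
    by (intro real_polynomial_function_diff real_polynomial_function_casimir
        real_polynomial_function.intros(4) real_polynomial_function.intros(2))
  have step: "(\<Sum>i\<in>I. d i * \<psi> i y) = poly (T q) (x \<bullet> y)"
    if "norm x = 1" "norm y = 1" "\<And>y. norm y = 1 \<Longrightarrow> (\<Sum>i\<in>I. d i * \<phi> i y) = poly q (x \<bullet> y)"
    for d q x y
  proof -
    have "(\<Sum>i\<in>I. d i * \<psi> i y) = (\<Sum>i\<in>I. d i * casimir (\<phi> i) y) - c * (\<Sum>i\<in>I. d i * \<phi> i y)"
      by (simp add: \<psi>_def sum_subtractf sum_distrib_left algebra_simps)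
    also have "\<dots> = poly (T q) (x \<bullet> y)"
      using casimir_zonal[where c = d and p = q, OF \<phi> that(1) that(3) that(2)] that
      by (simp add: T_def)
    finally show ?thesis .
  qed
  \<comment> \<open>After \<open>T\<close> in one variable the roles are swapped, so that
    \<open>step\<close> applies to the other with coefficients \<open>\<psi> i x\<close>.\<close>
  have one: "(\<Sum>i\<in>I. \<psi> i y * \<phi> i x) = poly (T p) (y \<bullet> x)"
    if "norm x = 1" "norm y = 1" for x y
    using step[of x y "\<lambda>i. \<phi> i x" p] that eq by (simp add: mult.commute inner_commute)
  have "(\<Sum>i\<in>I. \<psi> i x * \<psi> i y) = poly (T (T p)) (x \<bullet> y)"
    if "norm x = 1" "norm y = 1" for x y
    using step[of x y "\<lambda>i. \<psi> i x" "T p"] that one by simp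
  then show ?thesis
    unfolding feature_poly_def using \<open>finite I\<close> \<psi>
    by (intro exI[of _ I] exI[of _ \<psi>]) simp
qed

lemma feature_poly_psd:
  fixes u :: "'a \<Rightarrow> real ^ 'd::finite"
  assumes "feature_poly TYPE('d) p" and "\<And>x. x \<in> X \<Longrightarrow> norm (u x) = 1"
  shows "(\<Sum>x\<in>X. \<Sum>y\<in>X. c x * c y * poly p (u x \<bullet> u y)) \<ge> 0"
proof -
  obtain I :: "'d list set" and \<phi> :: "'d list \<Rightarrow> real ^ 'd \<Rightarrow> real" where
    eq: "\<And>x y. norm x = 1 \<Longrightarrow> norm y = 1 \<Longrightarrow> poly p (x \<bullet> y) = (\<Sum>i\<in>I. \<phi> i x * \<phi> i y)"
    using assms(1) unfolding feature_poly_def by blast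
  have "(\<Sum>x\<in>X. \<Sum>y\<in>X. c x * c y * poly p (u x \<bullet> u y))
      = (\<Sum>x\<in>X. \<Sum>y\<in>X. \<Sum>i\<in>I. (c x * \<phi> i (u x)) * (c y * \<phi> i (u y)))"
    using assms(2) by (intro sum.cong refl) (simp add: eq sum_distrib_left ac_simps)
  also have "\<dots> = (\<Sum>x\<in>X. \<Sum>i\<in>I. \<Sum>y\<in>X. (c x * \<phi> i (u x)) * (c y * \<phi> i (u y)))"
    by (rule sum.cong[OF refl], rule sum.swap)
  also have "\<dots> = (\<Sum>i\<in>I. \<Sum>x\<in>X. \<Sum>y\<in>X. (c x * \<phi> i (u x)) * (c y * \<phi> i (u y)))"
    by (rule sum.swap)
  also have "\<dots> = (\<Sum>i\<in>I. (\<Sum>x\<in>X. c x * \<phi> i (u x))\<^sup>2)"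
    by (simp add: power2_eq_square sum_product)
  also have "\<dots> \<ge> 0"
    by (intro sum_nonneg) simp
  finally show ?thesis .
qed

lemma ex_unit_vectors_inner:
  assumes "CARD('d::finite) \<ge> 2" and "t \<in> {-1..1}"
  obtains x y :: "real ^ 'd" where "norm x = 1" "norm y = 1" "x \<bullet> y = t"
proof -
  obtain a b :: 'd where "a \<noteq> b"
    using assms(1) by (metis (full_types) card_le_Suc0_iff_eq
        finite not_less_eq_eq numeral_2_eq_2)
  define y :: "real ^ 'd" where "y = t *\<^sub>R axis a 1 + sqrt (1 - t\<^sup>2) *\<^sub>R axis b 1"
  have t: "t\<^sup>2 \<le> 1"
    using assms(2) by (auto simp: abs_square_le_1 abs_le_iff)
  have "y \<bullet> y = 1"
    using t \<open>a \<noteq> b\<close>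
    by (simp add: y_def inner_add_left inner_add_right inner_axis_axis power2_eq_square[symmetric])
  then have "norm y = 1"
    by (simp add: norm_eq_sqrt_inner)
  moreover have "axis a 1 \<bullet> y = t"
    using \<open>a \<noteq> b\<close> by (simp add: y_def inner_add_right inner_axis_axis)
  ultimately show ?thesis
    by (intro that[of "axis a 1" y]) auto
qed

text \<open>The value at 1 is a sum of squares of features at any unit vector. If it were zero, all
  features would vanish on the sphere, and \<open>p\<close> on all of
  \<open>{-1..1}\<close>.\<close>

lemma feature_poly_pos_at_1:
  assumes "feature_poly TYPE('d::finite) p" and "CARD('d) \<ge> 2" and "p \<noteq> 0"
  shows "poly p 1 > 0"
proof -
  obtain I :: "'d list set" and \<phi> :: "'d list \<Rightarrow> real ^ 'd \<Rightarrow> real" where "finite I" and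
    eq: "\<And>x y. norm x = 1 \<Longrightarrow> norm y = 1 \<Longrightarrow> poly p (x \<bullet> y) = (\<Sum>i\<in>I. \<phi> i x * \<phi> i y)"
    using assms(1) unfolding feature_poly_def by blast
  have p1: "poly p 1 = (\<Sum>i\<in>I. (\<phi> i x)\<^sup>2)" if "norm x = 1" for x
    using eq[OF that that] that by (simp add: power2_eq_square flip: power2_norm_eq_inner)
  have "poly p 1 \<noteq> 0"
  proof
    assume "poly p 1 = 0"
    then have \<phi>0: "\<phi> i x = 0" if "i \<in> I" "norm x = 1" for i x
      using p1[OF that(2)] that(1) \<open>finite I\<close> by (simp add: sum_nonneg_eq_0_iff)
    have "poly p t = 0" if t: "t \<in> {-1..1}" for t
    proof -
      obtain x y :: "real ^ 'd" where "norm x = 1" "norm y = 1" "x \<bullet> y = t"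
        using ex_unit_vectors_inner[OF assms(2) t] .
      with eq[of x y] \<phi>0 show ?thesis
        by simp
    qed
    then have "{-1..1} \<subseteq> {t. poly p t = 0}"
      by blast
    from finite_subset[OF this poly_roots_finite[OF \<open>p \<noteq> 0\<close>]] show False
      by (simp add: infinite_Icc)
  qed
  moreover have "poly p 1 \<ge> 0"
    using p1[of "axis undefined 1"] by (simp add: sum_nonneg)
  ultimately show ?thesis
    by simp
qed

section \<open>Positive definiteness of the Gegenbauer polynomials\<close>

lemma dim_Harm_0: "dim_Harm TYPE('d::finite) 0 = 1"
proof -
  interpret V: vector_space "\<lambda>(c::real) (f :: real ^ 'd \<Rightarrow> real) x. c * f x"
    by (rule vector_space_real_fun)
  have one: "(\<lambda>_. 1) \<in> (Harm 0 :: (real ^ 'd \<Rightarrow> real) set)"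
    by (auto simp: Harm_def laplacian_def numeral_2_eq_2)
  have span: "p \<in> V.span {\<lambda>_. 1}" if "p \<in> Harm 0" for p :: "real ^ 'd \<Rightarrow> real"
  proof -
    \<comment> \<open>Scaling by zero: as \<open>0 ^ 0 = 1\<close>, homogeneity of degree 0 forces
      \<open>p\<close> to be constant.\<close>
    have "p (0 *\<^sub>R x) = 0 ^ 0 * p x" for x
      using that unfolding Harm_def by blast
    then have "p x = p 0" for x
      by (metis mult_1 power_0 scale_zero_left)
    then have "p = (\<lambda>x. p 0 * (\<lambda>_. 1) x)"
      by (simp add: fun_eq_iff)
    also have "\<dots> \<in> V.span {\<lambda>_. 1}"
      by (rule V.span_scale[OF V.span_base]) simp
    finally show ?thesis .
  qed
  have "V.independent {\<lambda>_. 1}"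
    by (subst V.dependent_single) (auto simp: fun_eq_iff)
  with one span show ?thesis
    unfolding dim_Harm_def by (intro V.dim_unique[where B = "{\<lambda>_. 1}"]) auto
qed

lemma gegenbauer_feature_poly:
  fixes Q :: "nat \<Rightarrow> real poly"
  assumes d: "CARD('d::finite) \<ge> 2" and Q: "gegenbauer_polys TYPE('d) Q"
  shows "\<exists>c>0. feature_poly TYPE('d) (smult c (Q j))"
proof -
  define n where "n = real CARD('d)"
  define ev where "ev = gegenbauer_eigenvalue n"
  have n: "n \<ge> 2"
    using d by (simp add: n_def)
  have deg: "degree (Q i) = i" and Q1: "poly (Q i) 1 = real (dim_Harm TYPE('d) i)" for i
    using Q by (auto simp: gegenbauer_polys_def)
  have orth: "((\<lambda>t. poly (Q i) t * poly (Q k) t * gegenbauer_weight n t) has_integral 0) {-1..1}"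
    if "i \<noteq> k" for i k
    using Q that by (auto simp: gegenbauer_polys_def gegenbauer_weight_def n_def)
  have nz: "Q i \<noteq> 0" for i
  proof (cases "i = 0")
    case True
    with Q1[of 0] show ?thesis
      by (auto simp: dim_Harm_0)
  next
    case False
    with deg[of i] show ?thesis
      by auto
  qed
  have eigen: "gegenbauer_op n (Q i) = smult (ev i) (Q i)" for i
    unfolding ev_def by (rule gegenbauer_op_eigenpoly[OF n deg nz orth])
  have "coeff (monom 1 j) k = (0::real)" if "k \<ge> Suc j" for k
    using that by simp
  from poly_in_span_of_degrees[OF deg nz this]
  obtain b where b: "monom 1 j = (\<Sum>i<Suc j. smult (b i) (Q i))"
    by blast
  \<comment> \<open>Each step applies the squared shifted operator for one more eigenvalue, which
    scales the coefficient of \<open>Q i\<close> by \<open>(ev i - ev k)\<^sup>2\<close>.\<close>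
  have kill: "feature_poly TYPE('d)
      (\<Sum>i<Suc j. smult (b i * (\<Prod>m<k. (ev i - ev m)\<^sup>2)) (Q i))" for k
  proof (induction k)
    case 0
    then show ?case
      using feature_poly_monom[of j, where 'd = 'd] b by simp
  next
    case (Suc k)
    have T: "gegenbauer_op n (\<Sum>i<Suc j. smult (a i) (Q i))
          - smult (ev k) (\<Sum>i<Suc j. smult (a i) (Q i))
        = (\<Sum>i<Suc j. smult (a i * (ev i - ev k)) (Q i))" for a
    proof -
      have "gegenbauer_op n (\<Sum>i<Suc j. smult (a i) (Q i))
          - smult (ev k) (\<Sum>i<Suc j. smult (a i) (Q i))
          = (\<Sum>i<Suc j. smult (a i * ev i) (Q i) - smult (ev k * a i) (Q i))"
        by (simp only: gegenbauer_op_sum gegenbauer_op_smult eigen smult_smult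
            smult_sum_right sum_subtractf)
      then show ?thesis
        by (simp only: smult_diff_left[symmetric] right_diff_distrib mult.commute)
    qed
    show ?case
      using feature_poly_gegenbauer_op[OF Suc.IH, of "ev k"]
      unfolding n_def[symmetric] T by (simp add: power2_eq_square ac_simps)
  qed
  define c where "c = b j * (\<Prod>m<j. (ev j - ev m)\<^sup>2)"
  have "(\<Sum>i<Suc j. smult (b i * (\<Prod>m<j. (ev i - ev m)\<^sup>2)) (Q i)) = smult c (Q j)"
  proof -
    \<comment> \<open>For \<open>i < j\<close> the product contains the zero factor
      \<open>m = i\<close>.\<close>
    have "(\<Sum>i<j. smult (b i * (\<Prod>m<j. (ev i - ev m)\<^sup>2)) (Q i)) = 0"
      by (intro sum.neutral) auto
    then show ?thesis
      by (simp add: c_def)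
  qed
  with kill[of j] have feature: "feature_poly TYPE('d) (smult c (Q j))"
    by simp
  have "coeff (monom 1 j) j = b j * coeff (Q j) j"
    unfolding b by (simp add: coeff_sum coeff_eq_0 deg)
  then have "b j \<noteq> 0"
    by auto
  moreover have "ev j - ev m \<noteq> 0" if "m < j" for m
    using gegenbauer_eigenvalue_strict_antimono[OF n that] by (simp add: ev_def)
  ultimately have "c \<noteq> 0"
    by (simp add: c_def)
  with feature_poly_pos_at_1[OF feature d] nz have "c * poly (Q j) 1 > 0"
    by simp
  then have "c > 0"
    by (simp add: Q1 zero_less_mult_iff)
  with feature show ?thesis
    by blast
qed

lemma gegenbauer_psd:
  fixes u :: "'a \<Rightarrow> real ^ 'd::finite"
  assumes "CARD('d) \<ge> 2" "gegenbauer_polys TYPE('d) Q" "\<And>x. x \<in> X \<Longrightarrow> norm (u x) = 1"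
  shows "(\<Sum>x\<in>X. \<Sum>y\<in>X. f x * f y * poly (Q j) (u x \<bullet> u y)) \<ge> 0"
proof -
  obtain c where "c > 0" and c: "feature_poly TYPE('d) (smult c (Q j))"
    using gegenbauer_feature_poly[OF assms(1,2)] by blast
  have "0 \<le> (\<Sum>x\<in>X. \<Sum>y\<in>X. f x * f y * poly (smult c (Q j)) (u x \<bullet> u y))"
    using c assms(3) by (rule feature_poly_psd)
  also have "\<dots> = c * (\<Sum>x\<in>X. \<Sum>y\<in>X. f x * f y * poly (Q j) (u x \<bullet> u y))"
    by (simp add: sum_distrib_left ac_simps)
  finally show ?thesis
    using \<open>c > 0\<close> by (simp add: zero_le_mult_iff)
qed

section \<open>Summation over pairs of code points\<close>

lemma has_sum_sum:
  fixes f :: "'b \<Rightarrow> 'a \<Rightarrow> real"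
  assumes "\<And>x. x \<in> X \<Longrightarrow> (f x has_sum s x) A"
  shows "((\<lambda>i. \<Sum>x\<in>X. f x i) has_sum (\<Sum>x\<in>X. s x)) A"
  using assms by (induction X rule: infinite_finite_induct) (auto intro: has_sum_add)

theorem theorem4p1:
  fixes a :: real
    and X :: "(real ^ 'd) set"
    and Q :: "nat \<Rightarrow> real poly"
    and g0 :: "real \<Rightarrow> real \<Rightarrow> real"
    and g :: "nat \<Rightarrow> nat \<Rightarrow> real \<Rightarrow> real"
    and h :: "real \<Rightarrow> real \<Rightarrow> real \<Rightarrow> real"
  assumes "CARD('d) \<ge> 2"
    and "a > 0"
    and "euclidean_code a X"
    and "0 \<notin> X"
    and "gegenbauer_polys TYPE('d) Q"
    and "\<And>r s t. r > 0 \<Longrightarrow> s > 0 \<Longrightarrow> t \<in> {-1..1} \<Longrightarrow>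
           (\<lambda>(i, j). g i j r * g i j s * poly (Q j) t) summable_on (UNIV \<times> {1..})"
    and "\<And>r s t. r > 0 \<Longrightarrow> s > 0 \<Longrightarrow> t \<in> {-1..1} \<Longrightarrow>
           h r s t = g0 r s +
             (\<Sum>\<^sub>\<infinity>(i, j)\<in>UNIV \<times> {1..}. g i j r * g i j s * poly (Q j) t)"
    and "\<And>r s t. r \<in> norm ` X \<Longrightarrow> s \<in> norm ` X \<Longrightarrow> t \<in> {-1..1} \<Longrightarrow>
           r\<^sup>2 + s\<^sup>2 - 2 * r * s * t \<ge> a\<^sup>2 \<Longrightarrow> h r s t \<le> 0"
  shows "(\<Sum>x\<in>X. \<Sum>y\<in>X. g0 (norm x) (norm y)) \<le> (\<Sum>x\<in>X. h (norm x) (norm x) 1)"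
proof -
  define u where "u x = x /\<^sub>R norm x" for x :: "real ^ 'd"
  define t where "t x y = u x \<bullet> u y" for x y
  define S where "S x y = (\<Sum>\<^sub>\<infinity>(i, j)\<in>UNIV \<times> {1..}.
      g i j (norm x) * g i j (norm y) * poly (Q j) (t x y))" for x y
  have fin: "finite X" and sep: "\<And>x y. x \<in> X \<Longrightarrow> y \<in> X \<Longrightarrow> x \<noteq> y \<Longrightarrow> norm (x - y) \<ge> a"
    using assms(3) by (auto simp: euclidean_code_def)
  have pos: "norm x > 0" if "x \<in> X" for x
    using that assms(4) by auto
  have u: "norm (u x) = 1" if "x \<in> X" for x
    using pos[OF that] by (simp add: u_def)
  have t: "t x y \<in> {-1..1}" if "x \<in> X" "y \<in> X" for x y
    using Cauchy_Schwarz_ineq2[of "u x" "u y"] u[OF that(1)] u[OF that(2)]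
    by (auto simp: t_def abs_le_iff)
  have inner: "norm x * norm y * t x y = x \<bullet> y" if "x \<in> X" "y \<in> X" for x y
    using pos[OF that(1)] pos[OF that(2)] by (simp add: t_def u_def field_simps)
  have h: "h (norm x) (norm y) (t x y) = g0 (norm x) (norm y) + S x y"
    if "x \<in> X" "y \<in> X" for x y
    unfolding S_def using that by (intro assms(7) pos t)
  \<comment> \<open>By the law of cosines, the separation of the code is exactly the condition under
    which \<open>h\<close> is assumed nonpositive.\<close>
  have h_neg: "h (norm x) (norm y) (t x y) \<le> 0" if "x \<in> X" "y \<in> X" "x \<noteq> y" for x y
  proof (rule assms(8))
    have "a\<^sup>2 \<le> (norm (x - y))\<^sup>2"
      using sep[OF that] assms(2) by (intro power_mono) auto
    also have "\<dots> = (norm x)\<^sup>2 + (norm y)\<^sup>2 - 2 * norm x * norm y * t x y"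
      using inner[OF that(1,2)]
      by (simp add: power2_norm_eq_inner inner_diff_left inner_diff_right inner_commute
          mult.assoc)
    finally show "a\<^sup>2 \<le> (norm x)\<^sup>2 + (norm y)\<^sup>2 - 2 * norm x * norm y * t x y" .
  qed (use that t in auto)
  \<comment> \<open>Exchange the finite sums with the series: for each \<open>(i, j)\<close> the
    double sum is a quadratic form of \<open>Q j\<close> with weights
    \<open>g i j (norm x)\<close>.\<close>
  have S_nonneg: "(\<Sum>x\<in>X. \<Sum>y\<in>X. S x y) \<ge> 0"
  proof (rule has_sum_nonneg)
    show "((\<lambda>ij. \<Sum>x\<in>X. \<Sum>y\<in>X.
        (case ij of (i, j) \<Rightarrow> g i j (norm x) * g i j (norm y) * poly (Q j) (t x y)))
        has_sum (\<Sum>x\<in>X. \<Sum>y\<in>X. S x y)) (UNIV \<times> {1..})"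
      unfolding S_def by (intro has_sum_sum has_sum_infsum assms(6) pos t)
    show "0 \<le> (\<Sum>x\<in>X. \<Sum>y\<in>X.
        (case ij of (i, j) \<Rightarrow> g i j (norm x) * g i j (norm y) * poly (Q j) (t x y)))" for ij
      using gegenbauer_psd[OF assms(1,5) u]
      by (cases ij) (simp add: t_def)
  qed
  have "(\<Sum>x\<in>X. \<Sum>y\<in>X. g0 (norm x) (norm y)) + (\<Sum>x\<in>X. \<Sum>y\<in>X. S x y)
      = (\<Sum>x\<in>X. \<Sum>y\<in>X. h (norm x) (norm y) (t x y))"
    by (simp add: h flip: sum.distrib)
  also have "\<dots> \<le> (\<Sum>x\<in>X. h (norm x) (norm x) 1)"
  \<comment> \<open>In each row only the diagonal term, where the cosine is 1, can be
    positive.\<close>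
  proof (rule sum_mono)
    fix x assume x: "x \<in> X"
    have "t x x = 1"
      using u[OF x] by (simp add: t_def norm_eq_1)
    moreover have "(\<Sum>y\<in>X - {x}. h (norm x) (norm y) (t x y)) \<le> 0"
      using x by (intro sum_nonpos h_neg) auto
    ultimately show "(\<Sum>y\<in>X. h (norm x) (norm y) (t x y)) \<le> h (norm x) (norm x) 1"
      by (simp add: sum.remove[OF fin x])
  qed
  finally show ?thesis
    using S_nonneg by simp
qed

end
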